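(* Let $2\le q<p\le\infty$, and let $$A=\begin{bmatrix}1&1&1&1&0&0\\1&-1&0&0&1&1\\0&0&1&-1&1&-1\end{bmatrix}.$$ Then $\|A\|_{p,q}^{\mathbb{C}}>\|A\|_{p,q}^{\mathbb{R}}$.
   Context: For a real matrix $A\in\mathbb{R}^{m\times n}$, $p,q\in[1,\infty]$ and $\mathbb{F}=\mathbb{R}$ or $\mathbb{C}$, $$\|A\|_{p,q}^{\mathbb{F}}=\sup_{x\in\mathbb{F}^n\setminus\{0\}}\frac{\|Ax\|_q}{\|x\|_p},$$ where $\|x\|_p=\left(\sum_t|x_t|^p\right)^{1/p}$ for $p<\infty$ and $\|x\|_\infty=\max_t|x_t|$. *)

theory Defs
  imports "HOL-Analysis.Analysis"
begin

text \<open>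
  The norm on \<open>F\<^sup>n\<close> for an exponent in \<open>[1, \<infinity>]\<close>. For exponents below 1 the
  value has no meaning.
\<close>

definition lp_norm :: "ereal \<Rightarrow> 'f::real_normed_field ^ 'n \<Rightarrow> real" where
  "lp_norm p x =
     (if p = \<infinity> then Max (range (\<lambda>t. norm (x $ t)))
      else (\<Sum>t\<in>UNIV. norm (x $ t) powr real_of_ereal p) powr (1 / real_of_ereal p))"

text \<open>
  The scalar field, over which the vectors \<open>x\<close> range, is passed as a type argument:
  \<open>TYPE(real)\<close> or \<open>TYPE(complex)\<close>. The real matrix is embedded entrywise by \<open>of_real\<close>.
  For exponents in \<open>[1, \<infinity>]\<close> the set of quotients is nonempty and bounded above
  (finite dimension), so the supremum in \<open>real\<close> is the true one.
\<close>

definition lpq_opnorm ::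
    "'f::real_normed_field itself \<Rightarrow> ereal \<Rightarrow> ereal \<Rightarrow> real ^ 'n ^ 'm \<Rightarrow> real" where
  "lpq_opnorm F p q A =
     (SUP x \<in> {x :: 'f ^ 'n. x \<noteq> 0}.
        lp_norm q ((map_matrix of_real A :: 'f ^ 'n ^ 'm) *v x) / lp_norm p x)"

text \<open>
  The function \<open>vector\<close> fills the indices \<open>1, 2, 3, \<dots>\<close> in order; in the index type \<open>6\<close>
  the last index is \<open>6 = 0\<close>, and in the type \<open>3\<close> it is \<open>3 = 0\<close>.
\<close>

definition matA :: "real ^ 6 ^ 3" where
  "matA = vector
     [vector [1,  1, 1,  1, 0,  0],
      vector [1, -1, 0,  0, 1,  1],
      vector [0,  0, 1, -1, 1, -1]]"

end

theory Submission
  imports Defs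
begin

text \<open>
  Write \<open>s\<close> and \<open>r\<close> for the exponents conjugate to \<open>p\<close> and \<open>q\<close>, so that
  \<open>1 \<le> s < r \<le> 2\<close>. By Hoelder's inequality and its equality case, over either field the norm
  of \<open>A\<close> from \<open>\<ell>\<^sup>p\<close> to \<open>\<ell>\<^sup>q\<close> is the norm of \<open>A\<^sup>T\<close> from
  \<open>\<ell>\<^sup>r\<close> to \<open>\<ell>\<^sup>s\<close> (\<open>transpose_ratio_ge\<close>). The transpose is easier to handle:
  the columns of \<open>A\<close> are \<open>e\<^sub>i + e\<^sub>j\<close> and \<open>e\<^sub>i - e\<^sub>j\<close> for the three pairs \<open>i < j\<close>, so
  the \<open>s\<close>-th power of the norm of \<open>A\<^sup>T z\<close> is the sum over these pairs of
  \<open>\<bar>z\<^sub>i + z\<^sub>j\<bar>\<^sup>s + \<bar>z\<^sub>i - z\<^sub>j\<bar>\<^sup>s\<close>.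

  For real \<open>a\<close> and \<open>b\<close>, the squares \<open>(a + b)\<^sup>2\<close> and \<open>(a - b)\<^sup>2\<close> have the mean \<open>a\<^sup>2 + b\<^sup>2\<close>, which
  is the common value of \<open>\<bar>a + \<i>b\<bar>\<^sup>2\<close> and \<open>\<bar>a - \<i>b\<bar>\<^sup>2\<close>. As \<open>u \<mapsto> u powr (s/2)\<close> is strictly
  concave, replacing \<open>b\<close> by \<open>\<i>b\<close> increases the contribution of the pair, strictly if
  \<open>a\<close> and \<open>b\<close> are nonzero (\<open>pair_sum_less_ii\<close>). So if a real \<open>z\<close> has two nonzero
  entries, multiplying one of them by \<open>\<i>\<close> leaves \<open>\<bar>z\<bar>\<^sub>r\<close> alone and raises \<open>\<bar>A\<^sup>T z\<bar>\<^sub>s\<close>.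
  If \<open>z\<close> has a single nonzero entry, a small second entry of relative size \<open>\<epsilon>\<close> gains a
  multiple of \<open>\<epsilon>\<^sup>s\<close> in the numerator and costs only a multiple of \<open>\<epsilon>\<^sup>r\<close> in the denominator, a gain
  because \<open>s < r\<close>. In both cases some complex vector does strictly better than \<open>z\<close>
  (\<open>complex_ratio_beats_real\<close>). By compactness (\<open>lp_norm_ratio_attains_max\<close>) the real supremum
  is attained, so beating every single real vector is enough.
\<close>

section \<open>The \<open>\<ell>\<^sup>p\<close> norms\<close>

text \<open>
  The exponent \<open>s\<close> stays real because a conjugate pair is always entered through a finite member;
  only the partner can be infinite.
\<close>

definition conj_exponent :: "real \<Rightarrow> ereal" where
  "conj_exponent s = (if s = 1 then \<infinity> else ereal (s / (s - 1)))"

lemma lp_norm_ereal: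
  "lp_norm (ereal r) x = (\<Sum>t\<in>UNIV. norm (x $ t) powr r) powr (1 / r)"
  by (simp add: lp_norm_def)

lemma lp_norm_ereal_powr:
  assumes "r \<noteq> 0"
  shows "lp_norm (ereal r) x powr r = (\<Sum>t\<in>UNIV. norm (x $ t) powr r)"
  using assms by (simp add: lp_norm_ereal powr_powr sum_nonneg)

lemma norm_nth_le_lp_norm:
  assumes "0 < p"
  shows "norm (x $ t) \<le> lp_norm p x"
proof (cases p)
  case (real r)
  with assms have r: "r > 0" by simp
  have "norm (x $ t) powr r \<le> (\<Sum>t\<in>UNIV. norm (x $ t) powr r)"
    by (rule member_le_sum) auto
  then have "(norm (x $ t) powr r) powr (1/r) \<le> lp_norm p x"
    using r by (simp add: real lp_norm_ereal powr_mono2)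
  then show ?thesis using r by (simp add: powr_powr)
qed (use assms in \<open>auto simp: lp_norm_def\<close>)

lemma lp_norm_nonneg:
  assumes "0 < p"
  shows "0 \<le> lp_norm p x"
  using norm_nth_le_lp_norm[OF assms] norm_ge_zero order_trans by blast

lemma lp_norm_pos:
  assumes "0 < p" "x \<noteq> 0"
  shows "0 < lp_norm p x"
proof -
  obtain t where "x $ t \<noteq> 0" using assms(2) by (auto simp: vec_eq_iff)
  then show ?thesis using norm_nth_le_lp_norm[OF assms(1), of x t]
    by (smt (verit) zero_less_norm_iff)
qed

lemma lp_norm_mono:
  assumes "0 < r" "\<And>t. norm (x $ t) \<le> norm (y $ t)"
  shows "lp_norm (ereal r) x \<le> lp_norm (ereal r) y"
  unfolding lp_norm_ereal using assms
  by (intro powr_mono2 sum_mono) (auto intro: sum_nonneg)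

lemma lp_norm_scale:
  assumes "0 < r"
  shows "lp_norm (ereal r) (c *s x) = norm c * lp_norm (ereal r) x"
  using assms by (simp add: lp_norm_ereal norm_mult powr_mult flip: sum_distrib_left)
    (simp add: powr_mult sum_nonneg powr_powr)

lemma lp_norm_0:
  shows "0 < r \<Longrightarrow> lp_norm (ereal r) 0 = 0"
  by (simp add: lp_norm_ereal)

lemma continuous_on_lp_norm:
  fixes f :: "'a::topological_space \<Rightarrow> 'f::real_normed_field ^ 'n"
  assumes "0 < r" "continuous_on S f"
  shows "continuous_on S (\<lambda>z. lp_norm (ereal r) (f z))"
  unfolding lp_norm_ereal using assms
  by (intro continuous_on_powr' continuous_intros) (auto intro: sum_nonneg)

lemma conj_exponent_pos: "1 \<le> s \<Longrightarrow> 0 < conj_exponent s"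
  by (simp add: conj_exponent_def)

section \<open>Hoelder duality\<close>

text \<open>
  For \<open>1 < s\<close>, normalise both vectors and sum Young's inequality over the entries. For
  \<open>s = 1\<close>, bound every entry of \<open>b\<close> by its maximum.
\<close>

lemma Holder_lp_norm:
  fixes a b :: "'f::real_normed_field ^ 'n"
  assumes "1 \<le> s"
  shows "norm (\<Sum>t\<in>UNIV. a $ t * b $ t) \<le> lp_norm (ereal s) a * lp_norm (conj_exponent s) b"
proof -
  have le: "norm (\<Sum>t\<in>UNIV. a $ t * b $ t) \<le> (\<Sum>t\<in>UNIV. norm (a $ t) * norm (b $ t))"
    by (rule order_trans[OF norm_sum]) (simp add: norm_mult)
  show ?thesis
  proof (cases "s = 1")
    case True
    have "(\<Sum>t\<in>UNIV. norm (a $ t) * norm (b $ t))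
        \<le> (\<Sum>t\<in>UNIV. norm (a $ t) * lp_norm (conj_exponent s) b)"
      using assms by (intro sum_mono mult_left_mono norm_nth_le_lp_norm conj_exponent_pos) auto
    also have "\<dots> = lp_norm (ereal s) a * lp_norm (conj_exponent s) b"
      using True by (simp add: lp_norm_ereal sum_distrib_right sum_nonneg)
    finally show ?thesis using le by simp
  next
    case False
    define p where "p = s / (s - 1)"
    have s: "s > 1" and p: "p > 1" and sp: "1/s + 1/p = 1" and p': "conj_exponent s = ereal p"
      using False assms by (auto simp: p_def conj_exponent_def field_simps)
    show ?thesis
    proof (cases "a = 0 \<or> b = 0")
      case True
      then show ?thesis using s p p' by (auto simp: lp_norm_0)
    next
      case False
      define A B where "A = lp_norm (ereal s) a" and "B = lp_norm (ereal p) b"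
      have AB: "A > 0" "B > 0" using s p False by (auto simp: A_def B_def intro!: lp_norm_pos)
      have "(\<Sum>t\<in>UNIV. (norm (a $ t) / A) * (norm (b $ t) / B))
         \<le> (\<Sum>t\<in>UNIV. (norm (a $ t) / A) powr s / s + (norm (b $ t) / B) powr p / p)"
        using s p sp AB by (intro sum_mono Youngs_inequality) auto
      also have "\<dots> = (\<Sum>t\<in>UNIV. norm (a $ t) powr s) / A powr s / s
                     + (\<Sum>t\<in>UNIV. norm (b $ t) powr p) / B powr p / p"
        using AB by (simp add: powr_divide sum.distrib sum_divide_distrib)
      also have "\<dots> = (A powr s) / A powr s / s + (B powr p) / B powr p / p"
        using s p by (simp add: A_def B_def lp_norm_ereal_powr)
      also have "\<dots> = 1" using AB sp by simp
      finally have "(\<Sum>t\<in>UNIV. norm (a $ t) * norm (b $ t)) \<le> A * B"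
        using AB by (simp add: field_simps flip: sum_divide_distrib)
      then show ?thesis using le by (simp add: A_def B_def p')
    qed
  qed
qed

text \<open>
  The extremal vector is \<open>b\<^sub>t = \<bar>a\<^sub>t\<bar>\<^sup>s / a\<^sub>t\<close>. It has \<open>\<bar>b\<^sub>t\<bar> = \<bar>a\<^sub>t\<bar>\<^bsup>s-1\<^esup>\<close>, and its phases cancel
  those of \<open>a\<close>. Division by zero makes \<open>b\<^sub>t = 0\<close> where \<open>a\<^sub>t = 0\<close>, also for \<open>s = 1\<close>.
\<close>

lemma Holder_lp_norm_attained:
  fixes a :: "'f::real_normed_field ^ 'n"
  assumes "1 \<le> s" "a \<noteq> 0"
  obtains b where "b \<noteq> 0"
    "(\<Sum>t\<in>UNIV. a $ t * b $ t) = of_real (lp_norm (ereal s) a * lp_norm (conj_exponent s) b)"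
proof -
  define b :: "'f ^ 'n" where "b = (\<chi> t. of_real (norm (a $ t) powr s) / a $ t)"
  obtain t0 where t0: "a $ t0 \<noteq> 0" using assms(2) by (auto simp: vec_eq_iff)
  then have b0: "b $ t0 \<noteq> 0" by (simp add: b_def)
  then have "b \<noteq> 0" by auto
  define S where "S = (\<Sum>t\<in>UNIV. norm (a $ t) powr s)"
  have "S \<ge> norm (a $ t0) powr s" unfolding S_def by (rule member_le_sum) auto
  with t0 have S: "S > 0" by (smt (verit) powr_gt_zero zero_less_norm_iff)
  have ab: "(\<Sum>t\<in>UNIV. a $ t * b $ t) = of_real S"
    unfolding S_def of_real_sum by (intro sum.cong refl) (auto simp: b_def)
  have nb: "norm (b $ t) = (if a $ t = 0 then 0 else norm (a $ t) powr (s - 1))" for t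
    by (simp add: b_def norm_divide powr_diff)
  have "lp_norm (ereal s) a * lp_norm (conj_exponent s) b = S"
  proof (cases "s = 1")
    case True
    have "Max (range (\<lambda>t. norm (b $ t))) = 1"
    proof (rule Max_eqI)
      show "1 \<in> range (\<lambda>t. norm (b $ t))" using t0 nb[of t0] True by (intro image_eqI[of _ _ t0]) auto
    qed (use nb True in auto)
    then show ?thesis using True S by (simp add: lp_norm_def conj_exponent_def S_def)
  next
    case False
    define p where "p = s / (s - 1)"
    have s: "s > 1" and p: "p > 1" and sp: "1/s + 1/p = 1" "(s - 1) * p = s" and p': "conj_exponent s = ereal p"
      using False assms by (auto simp: p_def conj_exponent_def field_simps)
    have "norm (b $ t) powr p = norm (a $ t) powr s" for t
      using sp by (simp add: nb powr_powr)
    then have "lp_norm (ereal s) a * lp_norm (conj_exponent s) b = S powr (1/s) * S powr (1/p)"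
      by (simp add: p' lp_norm_ereal S_def)
    also have "\<dots> = S" using S sp by (simp flip: powr_add)
    finally show ?thesis .
  qed
  with ab \<open>b \<noteq> 0\<close> that show thesis by metis
qed

lemma sum_matrix_transpose:
  fixes B :: "'f::comm_semiring_1 ^ 'n ^ 'm"
  shows "(\<Sum>i\<in>UNIV. (B *v x) $ i * z $ i) = (\<Sum>t\<in>UNIV. (transpose B *v z) $ t * x $ t)"
  unfolding matrix_vector_mult_def transpose_def
  by (simp add: sum_distrib_right sum_distrib_left)
     (subst sum.swap, intro sum.cong refl, simp add: mult_ac)

text \<open>
  Take \<open>z\<close> extremal for \<open>B x\<close> in Hoelder's inequality, move \<open>B\<close> to the other side of the
  pairing, and apply Hoelder's inequality to \<open>B\<^sup>T z\<close> and \<open>x\<close>. Applied to \<open>B\<close> and to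
  \<open>B\<^sup>T\<close>, this gives both inequalities between an operator norm and its dual.
\<close>

lemma transpose_ratio_ge:
  fixes B :: "'f::real_normed_field ^ 'n ^ 'm"
  assumes "1 \<le> q" "1 \<le> s" "B *v x \<noteq> 0"
  obtains z where "z \<noteq> 0"
    "lp_norm (ereal q) (B *v x) / lp_norm (conj_exponent s) x
      \<le> lp_norm (ereal s) (transpose B *v z) / lp_norm (conj_exponent q) z"
proof -
  obtain z where z: "z \<noteq> 0" "(\<Sum>i\<in>UNIV. (B *v x) $ i * z $ i) =
      of_real (lp_norm (ereal q) (B *v x) * lp_norm (conj_exponent q) z)"
    using Holder_lp_norm_attained[OF assms(1,3)] by blast
  have x: "x \<noteq> 0" using assms(3) by auto
  have pos: "lp_norm (conj_exponent s) x > 0" "lp_norm (conj_exponent q) z > 0"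
    using assms x z(1) by (auto intro!: lp_norm_pos conj_exponent_pos)
  have "lp_norm (ereal q) (B *v x) * lp_norm (conj_exponent q) z
      \<le> norm (\<Sum>t\<in>UNIV. (transpose B *v z) $ t * x $ t)"
    unfolding sum_matrix_transpose[symmetric] z(2) by (simp del: of_real_mult)
  also have "\<dots> \<le> lp_norm (ereal s) (transpose B *v z) * lp_norm (conj_exponent s) x"
    by (rule Holder_lp_norm[OF assms(2)])
  finally show thesis using that[OF z(1)] pos by (simp add: field_simps)
qed

section \<open>Boundedness and attainment of the quotients\<close>

text \<open>Without a bound, the supremum in \<open>lpq_opnorm\<close> need not be an upper bound of the quotients.\<close>

lemma bdd_above_lp_norm_ratio:
  fixes B :: "'f::real_normed_field ^ 'n ^ 'm"
  assumes "0 < q" "0 < p"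
  shows "bdd_above ((\<lambda>x. lp_norm (ereal q) (B *v x) / lp_norm p x) ` {x. x \<noteq> 0})"
proof -
  define K where "K = (\<Sum>i\<in>UNIV. \<Sum>t\<in>UNIV. norm (B $ i $ t))"
  show ?thesis
  proof (rule bdd_aboveI2)
    fix x :: "'f ^ 'n" assume "x \<in> {x. x \<noteq> 0}"
    then have L: "lp_norm p x > 0" using assms by (auto intro: lp_norm_pos)
    have "norm ((B *v x) $ i) \<le> K * lp_norm p x" for i
    proof -
      have "norm ((B *v x) $ i) \<le> (\<Sum>t\<in>UNIV. norm (B $ i $ t) * norm (x $ t))"
        unfolding matrix_vector_mult_def by (simp add: order_trans[OF norm_sum] norm_mult)
      also have "\<dots> \<le> (\<Sum>t\<in>UNIV. norm (B $ i $ t) * lp_norm p x)"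
        by (intro sum_mono mult_left_mono norm_nth_le_lp_norm assms) auto
      also have "\<dots> = (\<Sum>t\<in>UNIV. norm (B $ i $ t)) * lp_norm p x"
        by (simp add: sum_distrib_right)
      also have "\<dots> \<le> K * lp_norm p x"
        unfolding K_def using L
        by (intro mult_right_mono member_le_sum[of i UNIV "\<lambda>i. \<Sum>t\<in>UNIV. norm (B $ i $ t)"])
          (auto intro: sum_nonneg)
      finally show ?thesis .
    qed
    moreover have "K \<ge> 0" by (simp add: K_def sum_nonneg)
    ultimately have "lp_norm (ereal q) (B *v x)
        \<le> lp_norm (ereal q) (of_real (K * lp_norm p x) *s (\<chi> i. 1 :: 'f ^ 'm))"
      using assms(1) L by (intro lp_norm_mono) (auto simp: norm_mult)
    also have "\<dots> = \<bar>K * lp_norm p x\<bar> * lp_norm (ereal q) (\<chi> i. 1 :: 'f ^ 'm)"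
      using assms(1) by (simp add: lp_norm_scale del: of_real_mult)
    also have "\<dots> = K * lp_norm (ereal q) (\<chi> i. 1 :: 'f ^ 'm) * lp_norm p x"
      using L by (simp add: K_def sum_nonneg)
    finally show "lp_norm (ereal q) (B *v x) / lp_norm p x \<le> K * lp_norm (ereal q) (\<chi> i. 1 :: 'f ^ 'm)"
      using L by (simp add: field_simps)
  qed
qed

text \<open>
  The quotient is homogeneous of degree 0, so it is enough to maximise it over the Euclidean unit
  sphere, which is compact.
\<close>

lemma lp_norm_ratio_attains_max:
  fixes B :: "real ^ 'n ^ 'm"
  assumes "0 < s" "0 < r"
  obtains z0 where "z0 \<noteq> 0"
    "\<And>z. z \<noteq> 0 \<Longrightarrow> lp_norm (ereal s) (B *v z) / lp_norm (ereal r) z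
        \<le> lp_norm (ereal s) (B *v z0) / lp_norm (ereal r) z0"
proof -
  define \<phi> where "\<phi> = (\<lambda>z. lp_norm (ereal s) (B *v z) / lp_norm (ereal r) z)"
  have "continuous_on (sphere 0 1) \<phi>"
    unfolding \<phi>_def
  proof (intro continuous_on_divide continuous_on_lp_norm assms)
    show "continuous_on (sphere 0 1) ((*v) B)"
      by (simp add: linear_continuous_on)
    show "\<forall>x\<in>sphere (0 :: real ^ 'n) 1. lp_norm (ereal r) x \<noteq> 0"
    proof
      fix x :: "real ^ 'n" assume "x \<in> sphere 0 1"
      then show "lp_norm (ereal r) x \<noteq> 0"
        using lp_norm_pos[of "ereal r" x] assms by fastforce
    qed
  qed auto
  moreover have "sphere (0::real^'n) 1 \<noteq> {}" by simp
  ultimately obtain z0 where z0: "z0 \<in> sphere 0 1" "\<And>z. z \<in> sphere 0 1 \<Longrightarrow> \<phi> z \<le> \<phi> z0"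
    using continuous_attains_sup[of "sphere 0 1" \<phi>] by auto
  show thesis
  proof
    show "z0 \<noteq> 0" using z0(1) by auto
    fix z :: "real^'n" assume z: "z \<noteq> 0"
    have "\<phi> z = \<phi> ((1 / norm z) *s z)"
      using z assms by (simp add: \<phi>_def lp_norm_scale matrix_vector_mult_scaleR vector_scalar_commute)
    also have "\<dots> \<le> \<phi> z0" using z by (intro z0) (simp add: scalar_mult_eq_scaleR)
    finally show "lp_norm (ereal s) (B *v z) / lp_norm (ereal r) z
        \<le> lp_norm (ereal s) (B *v z0) / lp_norm (ereal r) z0" by (simp add: \<phi>_def)
  qed
qed

section \<open>Strict concavity of powers\<close>

lemma one_plus_less_exp:
  fixes y :: real
  assumes "y \<noteq> 0"
  shows "1 + y < exp y"
  using exp_ge_add_one_self[of y] ln_eq_minus_one[of "exp y"] assms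
  by (metis exp_eq_one_iff exp_gt_zero ln_exp less_eq_real_def add_diff_cancel_left')

text \<open>
  With \<open>v = exp L\<close>, this is the bound \<open>1 + y < exp y\<close> at the points \<open>-t L\<close> and \<open>(1 - t) L\<close>,
  averaged with the weights \<open>1 - t\<close> and \<open>t\<close> for which the linear terms cancel.
\<close>

lemma powr_less_tangent:
  fixes v :: real
  assumes "0 \<le> v" "v \<noteq> 1" "0 < t" "t < 1"
  shows "v powr t < 1 + t * (v - 1)"
proof (cases "v = 0")
  case False
  define L where "L = ln v"
  have v: "v = exp L" and L: "L \<noteq> 0" using False assms by (auto simp: L_def)
  have "1 + (-t * L) < exp (-t * L)" "1 + (1 - t) * L < exp ((1 - t) * L)"
    using L assms by (intro one_plus_less_exp; simp)+
  then have "(1 - t) * (1 + (-t * L)) + t * (1 + (1 - t) * L)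
      < (1 - t) * exp (-t * L) + t * exp ((1 - t) * L)"
    using assms by (intro add_strict_mono mult_strict_left_mono) auto
  then have "1 < (1 - t) * exp (-t * L) + t * exp ((1 - t) * L)"
    by (simp add: algebra_simps)
  then have "exp (t * L) * 1 < exp (t * L) * ((1 - t) * exp (-t * L) + t * exp ((1 - t) * L))"
    by (intro mult_strict_left_mono) auto
  also have "\<dots> = (1 - t) + t * exp L"
    by (simp add: algebra_simps flip: exp_add)
  finally show ?thesis by (simp add: v powr_def algebra_simps)
qed (use assms in auto)

text \<open>
  Strict midpoint concavity of \<open>u powr t\<close>: after division by the midpoint, add the tangent bounds at \<open>1\<close>;
  their linear terms cancel.
\<close>

lemma powr_add_less_midpoint:
  fixes x y :: real
  assumes "0 \<le> x" "0 \<le> y" "x \<noteq> y" "0 < t" "t < 1"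
  shows "x powr t + y powr t < 2 * ((x + y) / 2) powr t"
proof -
  define m where "m = (x + y) / 2"
  have m: "m > 0" "x \<noteq> m" "y \<noteq> m" using assms by (auto simp: m_def)
  have "(x / m) powr t + (y / m) powr t < (1 + t * (x / m - 1)) + (1 + t * (y / m - 1))"
    using assms m by (intro add_strict_mono powr_less_tangent) auto
  also have "\<dots> = 2 + t * ((x + y) / m - 2)" by (simp add: algebra_simps add_divide_distrib)
  also have "(x + y) / m = 2" using m by (simp add: m_def divide_simps)
  finally have "(x powr t + y powr t) / m powr t < 2"
    using m by (simp add: powr_divide add_divide_distrib)
  then show ?thesis using m by (simp add: field_simps m_def)
qed

section \<open>The transpose of the matrix\<close>

text \<open>The contribution of the two columns \<open>e\<^sub>i + e\<^sub>j\<close> and \<open>e\<^sub>i - e\<^sub>j\<close>.\<close>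

definition pair_sum :: "real \<Rightarrow> 'f::real_normed_field \<Rightarrow> 'f \<Rightarrow> real" where
  "pair_sum s a b = norm (a + b) powr s + norm (a - b) powr s"

lemma pair_sum_of_real: "pair_sum s (of_real a :: 'f::real_normed_field) (of_real b) = pair_sum s a b"
  unfolding pair_sum_def by (metis norm_of_real of_real_add of_real_diff real_norm_def)

lemma pair_sum_commute: "pair_sum s a b = pair_sum s b a"
  by (simp add: pair_sum_def add.commute norm_minus_commute)

lemma pair_sum_0:
  "pair_sum s a 0 = 2 * norm a powr s" "pair_sum s 0 a = 2 * norm a powr s"
  by (simp_all add: pair_sum_def)

lemma powr_eq_square_powr_half:
  fixes x :: real
  assumes "0 \<le> x"
  shows "x powr s = (x\<^sup>2) powr (s / 2)"
  using assms by (simp add: powr_powr flip: powr_numeral)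

lemma pair_sum_ii: "pair_sum s (complex_of_real a) (\<i> * of_real b) = 2 * (a\<^sup>2 + b\<^sup>2) powr (s / 2)"
proof -
  have "norm (complex_of_real a + \<i> * of_real b) powr s = (a\<^sup>2 + b\<^sup>2) powr (s / 2)"
    "norm (complex_of_real a - \<i> * of_real b) powr s = (a\<^sup>2 + b\<^sup>2) powr (s / 2)"
    by (subst powr_eq_square_powr_half; simp add: cmod_power2)+
  then show ?thesis by (simp add: pair_sum_def)
qed

text \<open>
  Over the reals the squared moduli \<open>(a + b)\<^sup>2\<close> and \<open>(a - b)\<^sup>2\<close> differ; the factor \<open>\<i>\<close> replaces both
  by their mean, and a strictly concave function gains from averaging.
\<close>

lemma pair_sum_less_ii:
  assumes "0 < s" "s < 2" "a \<noteq> 0" "b \<noteq> 0"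
  shows "pair_sum s a b < pair_sum s (complex_of_real a) (\<i> * of_real b)"
proof -
  have "pair_sum s a b = ((a + b)\<^sup>2) powr (s / 2) + ((a - b)\<^sup>2) powr (s / 2)"
    by (simp add: pair_sum_def powr_eq_square_powr_half[of "\<bar>_\<bar>"])
  also have "\<dots> < 2 * (((a + b)\<^sup>2 + (a - b)\<^sup>2) / 2) powr (s / 2)"
    using assms by (intro powr_add_less_midpoint) (auto simp: power2_eq_iff)
  also have "((a + b)\<^sup>2 + (a - b)\<^sup>2) / 2 = a\<^sup>2 + b\<^sup>2"
    by (simp add: power2_eq_square algebra_simps)
  finally show ?thesis by (simp add: pair_sum_ii)
qed

lemma pair_sum_le_ii:
  assumes "0 < s" "s < 2"
  shows "pair_sum s a b \<le> pair_sum s (complex_of_real a) (\<i> * of_real b)"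
proof (cases "a = 0 \<or> b = 0")
  case True
  then show ?thesis by (auto simp: pair_sum_def norm_mult)
next
  case False
  then show ?thesis using pair_sum_less_ii[OF assms, of a b] by simp
qed

definition triple_sum :: "real \<Rightarrow> 'f::real_normed_field ^ 3 \<Rightarrow> real" where
  "triple_sum s x = pair_sum s (x $ 1) (x $ 2) + pair_sum s (x $ 1) (x $ 3) + pair_sum s (x $ 2) (x $ 3)"

lemma UNIV_6: "UNIV = {1, 2, 3, 4, 5, 6::6}"
proof -
  have "x = 1 \<or> x = 2 \<or> x = 3 \<or> x = 4 \<or> x = 5 \<or> x = 6" for x :: 6
  proof (induct x)
    case (of_int z)
    then have "z = 0 \<or> z = 1 \<or> z = 2 \<or> z = 3 \<or> z = 4 \<or> z = 5" by fastforce
    then show ?case by auto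
  qed
  then show ?thesis by auto
qed

lemma sum_6: "sum f (UNIV::6 set) = f 1 + f 2 + f 3 + f 4 + f 5 + f 6"
  unfolding UNIV_6 by (simp add: ac_simps)

lemma vector_6:
  "(vector [a,b,c,d,e,f] :: 'a::zero^6) $ 1 = a"
  "(vector [a,b,c,d,e,f] :: 'a::zero^6) $ 2 = b"
  "(vector [a,b,c,d,e,f] :: 'a::zero^6) $ 3 = c"
  "(vector [a,b,c,d,e,f] :: 'a::zero^6) $ 4 = d"
  "(vector [a,b,c,d,e,f] :: 'a::zero^6) $ 5 = e"
  "(vector [a,b,c,d,e,f] :: 'a::zero^6) $ 6 = f"
  unfolding vector_def by simp_all

lemma lp_norm_transpose_matA:
  "lp_norm (ereal s) (transpose (map_matrix of_real matA) *v x) = triple_sum s x powr (1 / s)"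
  by (simp del: transpose_matrix_vector add: lp_norm_ereal sum_6 sum_3 matrix_vector_mult_def
      transpose_def map_matrix_def matA_def vector_6 triple_sum_def pair_sum_def add.assoc)

section \<open>Every real vector is beaten by a complex one\<close>

text \<open>
  The right-hand side is \<open>triple_sum s (1, \<i>\<epsilon>, 0)\<close>. The left-hand side is what it has to exceed
  so that this vector improves on the value \<open>4\<close> at \<open>(1, 0, 0)\<close>. Since \<open>s/r \<le> 1\<close>, the left-hand side is at most
  \<open>4 + 4 \<epsilon>\<^sup>r\<close>, while the right-hand side is at least \<open>4 + 2 \<epsilon>\<^sup>s\<close>.
\<close>

lemma perturbation_size:
  fixes r s :: real
  assumes "0 < s" "s < r" "r \<le> 2"
  obtains \<epsilon> where "0 < \<epsilon>" "4 * (1 + \<epsilon> powr r) powr (s / r) < 2 * (1 + \<epsilon>\<^sup>2) powr (s / 2) + 2 + 2 * \<epsilon> powr s"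
proof
  \<comment> \<open>Any value with \<open>\<epsilon>\<^bsup>r-s\<^esup> < 1/2\<close> makes \<open>4 \<epsilon>\<^sup>r < 2 \<epsilon>\<^sup>s\<close>; here \<open>\<epsilon>\<^bsup>r-s\<^esup> = 1/4\<close>.\<close>
  define \<epsilon> where "\<epsilon> = (1 / 4 :: real) powr (1 / (r - s))"
  show e: "0 < \<epsilon>" by (simp add: \<epsilon>_def)
  have "\<epsilon> powr r = \<epsilon> powr (r - s) * \<epsilon> powr s" by (simp flip: powr_add)
  also have "\<epsilon> powr (r - s) = 1 / 4" using assms by (simp add: \<epsilon>_def powr_powr)
  finally have er: "\<epsilon> powr r = \<epsilon> powr s / 4" by simp
  have "(1 + \<epsilon> powr r) powr (s / r) \<le> (1 + \<epsilon> powr r) powr 1"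
    using assms by (intro powr_mono) auto
  then have "4 * (1 + \<epsilon> powr r) powr (s / r) \<le> 4 + \<epsilon> powr s" by (simp add: er)
  moreover have "\<epsilon> powr s > 0" using e by simp
  moreover have "(1 + \<epsilon>\<^sup>2) powr (s / 2) \<ge> 1" using assms by (intro ge_one_powr_ge_zero) auto
  ultimately show "4 * (1 + \<epsilon> powr r) powr (s / r) < 2 * (1 + \<epsilon>\<^sup>2) powr (s / 2) + 2 + 2 * \<epsilon> powr s"
    by linarith
qed

lemma pair_sum_scale: "pair_sum s (c * a) (c * b) = norm c powr s * pair_sum s a b"
  unfolding pair_sum_def
  by (simp add: powr_mult norm_mult distrib_left flip: distrib_left right_diff_distrib)

text \<open>
  The previous estimate rescaled: both sides are homogeneous of degree \<open>s\<close> in \<open>(c, d)\<close>, so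
  \<open>d = c \<epsilon>\<close> works.
\<close>

lemma pair_sums_perturbed_axis:
  fixes c :: real
  assumes "0 < s" "s < r" "r \<le> 2" "c \<noteq> 0"
  obtains d :: real where
    "4 * (\<bar>c\<bar> powr r + \<bar>d\<bar> powr r) powr (s / r) <
      pair_sum s (of_real c) (\<i> * of_real d) + pair_sum s (of_real c :: complex) 0
        + pair_sum s (\<i> * of_real d) 0"
proof -
  obtain \<epsilon> where e: "0 < \<epsilon>"
    "4 * (1 + \<epsilon> powr r) powr (s / r) < 2 * (1 + \<epsilon>\<^sup>2) powr (s / 2) + 2 + 2 * \<epsilon> powr s"
    using perturbation_size assms by blast
  define d where "d = c * \<epsilon>"
  have "pair_sum s (of_real c) (\<i> * of_real d) = \<bar>c\<bar> powr s * pair_sum s (complex_of_real 1) (\<i> * of_real \<epsilon>)"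
    using pair_sum_scale[of s "complex_of_real c" 1 "\<i> * of_real \<epsilon>"] by (simp add: d_def mult_ac)
  also have "\<dots> = \<bar>c\<bar> powr s * (2 * (1 + \<epsilon>\<^sup>2) powr (s / 2))" by (simp only: pair_sum_ii) simp
  finally have "pair_sum s (of_real c) (\<i> * of_real d) + pair_sum s (of_real c :: complex) 0
        + pair_sum s (\<i> * of_real d) 0
      = \<bar>c\<bar> powr s * (2 * (1 + \<epsilon>\<^sup>2) powr (s / 2) + 2 + 2 * \<epsilon> powr s)"
    using e by (simp add: pair_sum_def d_def norm_mult abs_mult powr_mult algebra_simps)
  moreover have "(\<bar>c\<bar> powr r + \<bar>d\<bar> powr r) powr (s / r) = \<bar>c\<bar> powr s * (1 + \<epsilon> powr r) powr (s / r)"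
  proof -
    have "\<bar>c\<bar> powr r + \<bar>d\<bar> powr r = \<bar>c\<bar> powr r * (1 + \<epsilon> powr r)"
      using e by (simp add: d_def abs_mult powr_mult algebra_simps)
    then show ?thesis using assms by (simp add: powr_mult powr_powr)
  qed
  moreover have "\<bar>c\<bar> powr s * (4 * (1 + \<epsilon> powr r) powr (s / r))
      < \<bar>c\<bar> powr s * (2 * (1 + \<epsilon>\<^sup>2) powr (s / 2) + 2 + 2 * \<epsilon> powr s)"
    using e(2) assms by (intro mult_strict_left_mono) auto
  ultimately show thesis using that[of d] by simp
qed

text \<open>
  The vector \<open>w\<close> arises from \<open>z\<close> by multiplying one entry by \<open>\<i>\<close>, if \<open>z\<close> has at least two nonzero
  entries, and otherwise by adding a small imaginary entry. Both sides are the \<open>s\<close>-th powers of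
  the quotients of norms to be compared.
\<close>

lemma complex_triple_sum_beats_real:
  fixes z :: "real ^ 3"
  assumes "0 < s" "s < r" "r \<le> 2" "z \<noteq> 0"
  obtains w :: "complex ^ 3" where
    "triple_sum s z / (\<Sum>i\<in>UNIV. norm (z $ i) powr r) powr (s / r)
      < triple_sum s w / (\<Sum>i\<in>UNIV. norm (w $ i) powr r) powr (s / r)"
proof -
  note witness = that
  define a b c where "a = z $ 1" and "b = z $ 2" and "c = z $ 3"
  define N where "N = (\<Sum>i\<in>UNIV. norm (z $ i) powr r)"
  have N: "N = \<bar>a\<bar> powr r + \<bar>b\<bar> powr r + \<bar>c\<bar> powr r" by (simp add: N_def sum_3 a_def b_def c_def)
  have "\<exists>i. z $ i \<noteq> 0" using assms(4) by (auto simp: vec_eq_iff)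
  then have nz: "a \<noteq> 0 \<or> b \<noteq> 0 \<or> c \<noteq> 0" by (metis exhaust_3 a_def b_def c_def)
  then have "N > 0" unfolding N by (smt (verit) powr_gt_zero powr_ge_zero)
  then have Np: "N powr (s / r) > 0" by simp
  have F: "triple_sum s z = pair_sum s a b + pair_sum s a c + pair_sum s b c"
    by (simp add: triple_sum_def a_def b_def c_def)
  have s2: "s < 2" using assms by simp
  \<comment> \<open>The case of a single nonzero entry \<open>e\<close>, whatever its position; \<open>w d\<close> has the second
    entry \<open>\<i> d\<close>.\<close>
  have axis: thesis
    if e: "e \<noteq> 0" "triple_sum s z = 4 * \<bar>e\<bar> powr s" "N = \<bar>e\<bar> powr r"
      and w: "\<And>d. triple_sum s (w d) = pair_sum s (of_real e) (\<i> * of_real d)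
              + pair_sum s (of_real e :: complex) 0 + pair_sum s (\<i> * of_real d) 0"
        "\<And>d. (\<Sum>i\<in>UNIV. norm (w d $ i) powr r) = \<bar>e\<bar> powr r + \<bar>d\<bar> powr r"
    for e and w :: "real \<Rightarrow> complex ^ 3"
  proof -
    obtain d where d: "4 * (\<bar>e\<bar> powr r + \<bar>d\<bar> powr r) powr (s / r) < triple_sum s (w d)"
      using pair_sums_perturbed_axis[OF assms(1-3) e(1)] w(1) by metis
    have "N powr (s / r) = \<bar>e\<bar> powr s" using assms by (simp add: e(3) powr_powr)
    then have "triple_sum s z / N powr (s / r) = 4" using e by simp
    moreover have "\<bar>e\<bar> powr r + \<bar>d\<bar> powr r > 0" using e(1) by (simp add: add_pos_nonneg)
    then have "4 < triple_sum s (w d) / (\<bar>e\<bar> powr r + \<bar>d\<bar> powr r) powr (s / r)"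
      using d by (simp add: pos_less_divide_eq)
    ultimately show thesis using witness[of "w d"] w(2) by (simp add: N_def)
  qed
  \<comment> \<open>Multiplying the second entry by \<open>\<i>\<close> leaves the pair of the first and the third unchanged, so
    this is a strict gain exactly if the second entry and another one are nonzero.\<close>
  consider "b \<noteq> 0" "a \<noteq> 0 \<or> c \<noteq> 0" | "b = 0" "a \<noteq> 0" "c \<noteq> 0" |
     "a \<noteq> 0" "b = 0" "c = 0" | "a = 0" "b \<noteq> 0" "c = 0" | "a = 0" "b = 0" "c \<noteq> 0"
    using nz by blast
  then show thesis
  proof cases
    case 1
    define w :: "complex ^ 3" where "w = vector [of_real a, \<i> * of_real b, of_real c]"
    have "triple_sum s z < triple_sum s w"
      using 1 pair_sum_le_ii[OF assms(1) s2, of a b] pair_sum_le_ii[OF assms(1) s2, of c b]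
        pair_sum_less_ii[OF assms(1) s2, of a b] pair_sum_less_ii[OF assms(1) s2, of c b]
      unfolding F pair_sum_commute[of s b c]
      by (auto simp: w_def triple_sum_def pair_sum_of_real pair_sum_commute[of s _ "of_real c"])
    then show thesis using Np by (intro that[of w])
       (simp add: divide_strict_right_mono w_def sum_3 norm_mult a_def b_def c_def N_def)
  next
    case 2
    define w :: "complex ^ 3" where "w = vector [of_real a, of_real b, \<i> * of_real c]"
    have "triple_sum s z < triple_sum s w"
      using 2 pair_sum_less_ii[OF assms(1) s2, of a c]
      unfolding F by (simp add: w_def triple_sum_def pair_sum_def norm_mult)
    then show thesis using Np by (intro that[of w])
       (simp add: divide_strict_right_mono w_def sum_3 norm_mult a_def b_def c_def N_def)
  next
    case 3
    show thesis
      by (rule axis[of a "\<lambda>d. vector [of_real a, \<i> * of_real d, 0]"])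
        (simp_all add: F N 3 pair_sum_0 triple_sum_def[of s "_ :: complex ^ 3"] sum_3
          norm_mult)
  next
    case 4
    show thesis
      by (rule axis[of b "\<lambda>d. vector [\<i> * of_real d, of_real b, 0]"])
        (simp_all add: F N 4 pair_sum_0 triple_sum_def[of s "_ :: complex ^ 3"] sum_3
          norm_mult pair_sum_commute[of s "\<i> * _" "of_real b"])
  next
    case 5
    show thesis
      by (rule axis[of c "\<lambda>d. vector [\<i> * of_real d, 0, of_real c]"])
        (simp_all add: F N 5 pair_sum_0 triple_sum_def[of s "_ :: complex ^ 3"] sum_3
          norm_mult pair_sum_commute[of s "\<i> * _" "of_real c"])
  qed
qed

lemma complex_ratio_beats_real:
  fixes z :: "real ^ 3"
  assumes "0 < s" "s < r" "r \<le> 2" "z \<noteq> 0"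
  obtains w :: "complex ^ 3" where
    "lp_norm (ereal s) (transpose (map_matrix of_real matA) *v z) / lp_norm (ereal r) z
      < lp_norm (ereal s) (transpose (map_matrix of_real matA) *v w) / lp_norm (ereal r) w"
proof -
  obtain w :: "complex ^ 3" where w:
    "triple_sum s z / (\<Sum>i\<in>UNIV. norm (z $ i) powr r) powr (s / r)
      < triple_sum s w / (\<Sum>i\<in>UNIV. norm (w $ i) powr r) powr (s / r)"
    using complex_triple_sum_beats_real assms by blast
  have *: "lp_norm (ereal s) (transpose (map_matrix of_real matA) *v x) / lp_norm (ereal r) x
     = (triple_sum s x / (\<Sum>i\<in>UNIV. norm (x $ i) powr r) powr (s / r)) powr (1 / s)"
    for x :: "'f::real_normed_field ^ 3"
    using assms by (subst powr_divide) (simp_all del: transpose_matrix_vector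
      add: lp_norm_transpose_matA lp_norm_ereal[of r] powr_powr)
  show thesis
    by (rule that[of w], unfold *, rule powr_less_mono2[OF _ _ w])
      (use assms in \<open>auto simp: triple_sum_def pair_sum_def\<close>)
qed

theorem corollary4p3:
  fixes p q :: ereal
  assumes "2 \<le> q" and "q < p" and "p \<le> \<infinity>"
  shows "lpq_opnorm TYPE(complex) p q matA > lpq_opnorm TYPE(real) p q matA"
proof -
  obtain q' where q: "q = ereal q'" "2 \<le> q'" using assms by (cases q) auto
  define r where "r = q' / (q' - 1)"
  have r: "1 \<le> r" "r \<le> 2" and cq: "conj_exponent q' = ereal r"
    using q(2) by (auto simp: r_def conj_exponent_def field_simps)
  define s where "s = (if p = \<infinity> then 1 else real_of_ereal p / (real_of_ereal p - 1))"
  have "1 \<le> s \<and> s < r \<and> conj_exponent s = p"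
  proof (cases p)
    case (real p')
    then have "q' < p'" using assms q by simp
    then show ?thesis using q real by (auto simp: s_def r_def conj_exponent_def field_simps)
  qed (use assms q in \<open>auto simp: s_def r_def conj_exponent_def field_simps\<close>)
  then have s: "1 \<le> s" "s < r" and cs: "conj_exponent s = p" by auto
  define R C where "R = (map_matrix of_real matA :: real ^ 6 ^ 3)"
    and "C = (map_matrix of_real matA :: complex ^ 6 ^ 3)"
  obtain z0 where z0: "z0 \<noteq> 0"
    "\<And>z. z \<noteq> 0 \<Longrightarrow> lp_norm (ereal s) (transpose R *v z) / lp_norm (ereal r) z
        \<le> lp_norm (ereal s) (transpose R *v z0) / lp_norm (ereal r) z0"
    using lp_norm_ratio_attains_max[of s r "transpose R"] s r by auto
  define M where "M = lp_norm (ereal s) (transpose R *v z0) / lp_norm (ereal r) z0"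
  have M: "M \<ge> 0" using s r by (auto simp: M_def intro!: divide_nonneg_nonneg lp_norm_nonneg)
  have "lpq_opnorm TYPE(real) p q matA \<le> M"
    unfolding lpq_opnorm_def R_def[symmetric]
  proof (rule cSUP_least)
    show "{x :: real ^ 6. x \<noteq> 0} \<noteq> {}" using zero_neq_one by blast
    fix x :: "real ^ 6"
    show "lp_norm q (R *v x) / lp_norm p x \<le> M"
    proof (cases "R *v x = 0")
      case True
      then show ?thesis using M q by (simp add: lp_norm_0)
    next
      case False
      from transpose_ratio_ge[OF _ s(1) this, of q'] q(2) obtain z where z: "z \<noteq> 0"
        "lp_norm (ereal q') (R *v x) / lp_norm p x \<le> lp_norm (ereal s) (transpose R *v z) / lp_norm (ereal r) z"
        unfolding cs cq by auto
      then show ?thesis using z0(2)[OF z(1)] by (simp add: M_def q)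
    qed
  qed
  also obtain w where w: "M < lp_norm (ereal s) (transpose C *v w) / lp_norm (ereal r) w"
    using complex_ratio_beats_real[of s r z0] s r z0(1) unfolding M_def R_def C_def by auto
  note w
  also have "lp_norm (ereal s) (transpose C *v w) / lp_norm (ereal r) w \<le> lpq_opnorm TYPE(complex) p q matA"
  proof -
    have "transpose C *v w \<noteq> 0"
    proof
      assume "transpose C *v w = 0"
      then have "lp_norm (ereal s) (transpose C *v w) = 0" using s by (simp only:) (simp add: lp_norm_0)
      with w M show False by simp
    qed
    from transpose_ratio_ge[OF s(1) _ this, of q'] q(2) obtain x where x: "x \<noteq> 0"
      "lp_norm (ereal s) (transpose C *v w) / lp_norm (ereal r) w \<le> lp_norm q (C *v x) / lp_norm p x"
      unfolding cs cq q(1) transpose_transpose by auto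
    have p0: "0 < p" using conj_exponent_pos[OF s(1)] by (simp add: cs)
    have "lp_norm q (C *v x) / lp_norm p x \<le> lpq_opnorm TYPE(complex) p q matA"
      unfolding lpq_opnorm_def C_def[symmetric] q(1)
      using x(1) q(2) by (intro cSUP_upper bdd_above_lp_norm_ratio p0) auto
    with x(2) show ?thesis by simp
  qed
  finally show ?thesis .
qed

end
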